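(* Let $n_1,n_2\in\mathbb{N}$ and let $f$ be an entire function. Then $f$ preserves nonnegativity of block upper-triangular matrices of the form $$\begin{bmatrix} A & B\\ 0 & C\end{bmatrix},\qquad A\in\mathbb{R}^{n_1\times n_1},\quad C\in\mathbb{R}^{n_2\times n_2}$$ (i.e., $f$ maps every entrywise nonnegative real matrix of this form to an entrywise nonnegative matrix) if and only if both of the following hold: (a) $f\in\mathcal{F}_N$, where $N=\max\{n_1,n_2\}$; and (b) $f(A)X-Xf(C)\ge 0$ for every $A\in\mathbb{R}^{n_1\times n_1}$, $B\in\mathbb{R}^{n_1\times n_2}$, $C\in\mathbb{R}^{n_2\times n_2}$ such that $A,B,C\ge 0$ and $\sigma(A)\cap\sigma(C)=\emptyset$, where $X$ is the (unique) matrix satisfying the equation $AX-XC=B$.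
   Context: For a matrix $M$, $M\ge0$ means that $M$ is entrywise nonnegative (real entries), and $\sigma(M)$ is its spectrum. For an entire $f(z)=\sum_{j\ge0}a_jz^j$, $f(A)=\sum_{j\ge0}a_jA^j$ is the usual (primary) matrix function. For $n\in\mathbb{N}$, $$\mathcal{F}_n=\{\,f \text{ entire} : A\in\mathbb{R}^{n\times n},\ A\ge 0\ \Longrightarrow\ f(A)\ge 0\,\}.$$ *)

theory Defs
  imports
    "HOL-Complex_Analysis.Complex_Analysis"
    "Jordan_Normal_Form.Matrix"
    "Jordan_Normal_Form.Spectral_Radius"
begin

text \<open>Entrywise nonnegativity. For complex entries, \<open>0 \<le> z\<close> is the order of
  \<open>HOL-Library.Complex_Order\<close>, that is, \<open>z\<close> is real and nonnegative.\<close>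

definition nonneg_mat :: "'a :: {zero, ord} mat \<Rightarrow> bool" where
  "nonneg_mat M \<longleftrightarrow> 0\<^sub>m (dim_row M) (dim_col M) \<le> M"

text \<open>The spectrum of a real matrix \<open>A\<close> is the complex one, \<open>spectrum (cmat A)\<close>; \<open>spectrum A\<close>
  would contain only the real eigenvalues.\<close>

definition cmat :: "real mat \<Rightarrow> complex mat" where
  "cmat = map_mat complex_of_real"

definition entire :: "(complex \<Rightarrow> complex) \<Rightarrow> bool" where
  "entire f \<longleftrightarrow> f holomorphic_on UNIV"

definition taylor_coeff :: "(complex \<Rightarrow> complex) \<Rightarrow> nat \<Rightarrow> complex" where
  "taylor_coeff f k = (deriv ^^ k) f 0 / fact k"

text \<open>The power series \<open>\<Sum>k. a\<^sub>k A\<^sup>k\<close> is summed entrywise; for entire \<open>f\<close> it converges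
  for every square matrix \<open>A\<close>.\<close>

definition mat_fun :: "(complex \<Rightarrow> complex) \<Rightarrow> complex mat \<Rightarrow> complex mat" where
  "mat_fun f A = mat (dim_row A) (dim_row A)
     (\<lambda>(i, j). \<Sum>k. taylor_coeff f k * (A ^\<^sub>m k) $$ (i, j))"

definition nonneg_preserving :: "nat \<Rightarrow> (complex \<Rightarrow> complex) set" where
  "nonneg_preserving n = {f. entire f \<and>
     (\<forall>A \<in> carrier_mat n n. nonneg_mat A \<longrightarrow> nonneg_mat (mat_fun f (cmat A)))}"

definition preserves_block_triangular :: "nat \<Rightarrow> nat \<Rightarrow> (complex \<Rightarrow> complex) \<Rightarrow> bool" where
  "preserves_block_triangular n\<^sub>1 n\<^sub>2 f \<longleftrightarrow>
     (\<forall>A \<in> carrier_mat n\<^sub>1 n\<^sub>1. \<forall>B \<in> carrier_mat n\<^sub>1 n\<^sub>2. \<forall>C \<in> carrier_mat n\<^sub>2 n\<^sub>2.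
        let M = four_block_mat A B (0\<^sub>m n\<^sub>2 n\<^sub>1) C
        in nonneg_mat M \<longrightarrow> nonneg_mat (mat_fun f (cmat M)))"

end

theory Submission
  imports Defs
begin

text \<open>If \<open>A X - X C = B\<close>, then conjugating \<open>diag(A, C)\<close> by the unipotent matrix built from \<open>X\<close> shows
  that the upper right block of the \<open>k\<close>-th power of \<open>[[A, B], [0, C]]\<close> is \<open>A\<^sup>k X - X C\<^sup>k\<close>, so that
  the upper right block of its image under \<open>f\<close> is \<open>f(A) X - X f(C)\<close>. This gives the theorem
  whenever the spectra are disjoint; the case \<open>B = X = 0\<close> gives condition (a) and the monotonicity of
  the classes \<open>F\<^sub>n\<close>. For arbitrary \<open>A\<close> and \<open>C\<close>, replace \<open>A\<close> by \<open>A + e I\<close> with \<open>e > 0\<close>: outside a finite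
  set of \<open>e\<close> the Sylvester equation is solvable and the spectra are disjoint, and nonnegativity
  passes to the limit \<open>e \<rightarrow> 0\<close> because the power series defining \<open>f\<close> converges uniformly.\<close>

section \<open>Matrix functions\<close>

lemma nonneg_mat_iff:
  assumes "M \<in> carrier_mat m n"
  shows "nonneg_mat M \<longleftrightarrow> (\<forall>i<m. \<forall>j<n. 0 \<le> M $$ (i, j))"
  using assms by (auto simp: nonneg_mat_def less_eq_mat_def)

lemma nonneg_four_block_mat_iff:
  assumes "A \<in> carrier_mat m1 n1" "B \<in> carrier_mat m1 n2"
    and "C \<in> carrier_mat m2 n1" "D \<in> carrier_mat m2 n2"
  shows "nonneg_mat (four_block_mat A B C D) \<longleftrightarrow>
    nonneg_mat A \<and> nonneg_mat B \<and> nonneg_mat C \<and> nonneg_mat D"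
proof -
  have carrier: "four_block_mat A B C D \<in> carrier_mat (m1 + m2) (n1 + n2)"
    using assms by auto
  have split: "(\<forall>i<p + q. P i) \<longleftrightarrow> (\<forall>i<p. P i) \<and> (\<forall>i<q. P (i + p))" for p q :: nat and P
  proof (intro iffI conjI allI impI)
    fix i
    assume "(\<forall>i<p. P i) \<and> (\<forall>i<q. P (i + p))" "i < p + q"
    then show "P i"
      by (cases "i < p") (auto dest!: spec[of _ "i - p"])
  qed auto
  show ?thesis
    unfolding nonneg_mat_iff[OF carrier] nonneg_mat_iff[OF assms(1)] nonneg_mat_iff[OF assms(2)]
      nonneg_mat_iff[OF assms(3)] nonneg_mat_iff[OF assms(4)] split
    using assms by auto
qed

lemma cmat_carrier [simp]: "cmat A \<in> carrier_mat m n \<longleftrightarrow> A \<in> carrier_mat m n"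
  by (simp add: cmat_def)

lemma cmat_zero [simp]: "cmat (0\<^sub>m m n) = 0\<^sub>m m n"
  by (rule eq_matI) (auto simp: cmat_def)

lemma cmat_minus:
  assumes "A \<in> carrier_mat m n" "B \<in> carrier_mat m n"
  shows "cmat (A - B) = cmat A - cmat B"
  using assms by (intro eq_matI) (auto simp: cmat_def)

lemma cmat_mult:
  assumes "A \<in> carrier_mat m n" "B \<in> carrier_mat n p"
  shows "cmat (A * B) = cmat A * cmat B"
  unfolding cmat_def by (rule of_real_hom.mat_hom_mult[OF assms])

lemma cmat_four_block_mat:
  assumes "A \<in> carrier_mat m1 n1" "B \<in> carrier_mat m1 n2"
    and "C \<in> carrier_mat m2 n1" "D \<in> carrier_mat m2 n2"
  shows "cmat (four_block_mat A B C D) = four_block_mat (cmat A) (cmat B) (cmat C) (cmat D)"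
  unfolding cmat_def by (rule map_four_block_mat[OF assms])

lemma index_mult_mat_sum:
  assumes "A \<in> carrier_mat m n" "B \<in> carrier_mat n p" "i < m" "j < p"
  shows "(A * B) $$ (i, j) = (\<Sum>l<n. A $$ (i, l) * B $$ (l, j))"
  using assms by (auto simp: scalar_prod_def atLeast0LessThan intro!: sum.cong)

section \<open>Convergence of the power series, entry by entry\<close>

lemma norm_pow_mat_index_le:
  fixes A :: "complex mat"
  assumes A: "A \<in> carrier_mat n n" and r: "0 \<le> r"
    and bound: "\<And>i j. i < n \<Longrightarrow> j < n \<Longrightarrow> norm (A $$ (i, j)) \<le> r"
    and ij: "i < n" "j < n"
  shows "norm ((A ^\<^sub>m k) $$ (i, j)) \<le> (1 + n * r) ^ k"
  using ij
proof (induction k arbitrary: i j)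
  case 0
  then show ?case using A by auto
next
  case (Suc k)
  have "(A ^\<^sub>m Suc k) $$ (i, j) = (\<Sum>l<n. (A ^\<^sub>m k) $$ (i, l) * A $$ (l, j))"
    using index_mult_mat_sum[of "A ^\<^sub>m k" n n A n i j] A Suc.prems by simp
  \<comment> \<open>Each of the \<open>n\<close> summands gains one factor of size at most
    \<open>r\<close>. The result is a geometric bound whose ratio depends on \<open>n\<close> and
    \<open>r\<close> only, which the Taylor series of an entire function can absorb.\<close>
  also have "norm \<dots> \<le> (\<Sum>l<n. (1 + n * r) ^ k * r)"
    using Suc bound r by (intro sum_norm_le) (auto simp: norm_mult intro!: mult_mono)
  also have "\<dots> = (1 + n * r) ^ k * (n * r)"
    by simp
  also have "\<dots> \<le> (1 + n * r) ^ Suc k"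
    using r by (simp add: algebra_simps)
  finally show ?case .
qed

lemma summable_norm_taylor_coeff:
  assumes "entire f"
  shows "summable (\<lambda>k. norm (taylor_coeff f k) * R ^ k)"
proof -
  \<comment> \<open>Convergence at a point of modulus strictly larger than
    \<open>\<bar>R\<bar>\<close> forces absolute convergence at \<open>R\<close>.\<close>
  let ?x = "complex_of_real (\<bar>R\<bar> + 1)"
  have "f holomorphic_on ball 0 (\<bar>R\<bar> + 2)"
    using assms holomorphic_on_subset by (auto simp: entire_def)
  from holomorphic_power_series[OF this, of ?x]
  have "summable (\<lambda>k. taylor_coeff f k * ?x ^ k)"
    by (auto simp: taylor_coeff_def sums_iff)
  then have "summable (\<lambda>k. norm (taylor_coeff f k * (of_real R) ^ k))"
    by (rule powser_insidea) auto
  then have "summable (\<lambda>k. norm (norm (taylor_coeff f k) * R ^ k))"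
    by (simp add: norm_mult norm_power abs_mult power_abs)
  then show ?thesis
    by (rule summable_norm_cancel)
qed

lemma mat_entries_bounded:
  fixes A :: "complex mat"
  obtains r where "0 \<le> r" "\<And>i j. i < n \<Longrightarrow> j < n \<Longrightarrow> norm (A $$ (i, j)) \<le> r"
proof
  \<comment> \<open>The sum of all norms dominates each of them and, unlike a maximum, makes sense
    for \<open>n = 0\<close> too.\<close>
  let ?r = "\<Sum>p\<in>{..<n} \<times> {..<n}. norm (A $$ p)"
  show "0 \<le> ?r"
    by (simp add: sum_nonneg)
  show "norm (A $$ (i, j)) \<le> ?r" if "i < n" "j < n" for i j
    using that member_le_sum[of "(i, j)" "{..<n} \<times> {..<n}" "\<lambda>p. norm (A $$ p)"] by auto
qed

lemma mat_fun_carrier [simp]: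
  "A \<in> carrier_mat n n \<Longrightarrow> mat_fun f A \<in> carrier_mat n n"
  by (auto simp: mat_fun_def)

text \<open>\<open>mat_fun\<close> is written with \<open>\<Sum>k\<close>, which by itself carries
  no convergence; the geometric bound on the entries of the powers, set against the absolutely
  convergent Taylor series, supplies it.\<close>

lemma mat_fun_sums:
  assumes f: "entire f" and A: "A \<in> carrier_mat n n" and ij: "i < n" "j < n"
  shows "(\<lambda>k. taylor_coeff f k * (A ^\<^sub>m k) $$ (i, j)) sums mat_fun f A $$ (i, j)"
proof -
  obtain r where r: "0 \<le> r" "\<And>i j. i < n \<Longrightarrow> j < n \<Longrightarrow> norm (A $$ (i, j)) \<le> r"
    using mat_entries_bounded[of n A] by blast
  have "summable (\<lambda>k. taylor_coeff f k * (A ^\<^sub>m k) $$ (i, j))"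
    using norm_pow_mat_index_le[OF A r ij]
    by (intro summable_comparison_test'[OF summable_norm_taylor_coeff[OF f, of "1 + n * r"]])
       (auto simp: norm_mult mult_left_mono)
  then show ?thesis
    using A ij by (simp add: mat_fun_def summable_sums)
qed

section \<open>Passage to the limit in matrix functions\<close>

lemma tendsto_pow_mat_index:
  fixes M :: "'b \<Rightarrow> 'a::{real_normed_algebra_1} mat"
  assumes M: "\<And>e. M e \<in> carrier_mat n n" and L: "L \<in> carrier_mat n n"
    and lim: "\<And>i j. i < n \<Longrightarrow> j < n \<Longrightarrow> ((\<lambda>e. M e $$ (i, j)) \<longlongrightarrow> L $$ (i, j)) F"
    and ij: "i < n" "j < n"
  shows "((\<lambda>e. (M e ^\<^sub>m k) $$ (i, j)) \<longlongrightarrow> (L ^\<^sub>m k) $$ (i, j)) F"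
  using ij
proof (induction k arbitrary: i j)
  case 0
  have "dim_row (M e) = n" for e
    using M by auto
  then show ?case using L by simp
next
  case (Suc k)
  have "(N ^\<^sub>m Suc k) $$ (i, j) = (\<Sum>l<n. (N ^\<^sub>m k) $$ (i, l) * N $$ (l, j))"
    if "N \<in> carrier_mat n n" for N :: "'a mat"
    using index_mult_mat_sum[of "N ^\<^sub>m k" n n N n i j] that Suc.prems by simp
  then show ?case
    using M L Suc lim by (auto simp del: pow_mat.simps intro!: tendsto_sum tendsto_mult)
qed

text \<open>The powers converge entry by entry, and Tannery's theorem moves the limit inside the
  series once its terms have a summable majorant independent of \<open>e\<close>.\<close>

lemma tendsto_mat_fun_index:
  assumes f: "entire f"
    and M: "\<And>e. M e \<in> carrier_mat n n" and L: "L \<in> carrier_mat n n"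
    and lim: "\<And>i j. i < n \<Longrightarrow> j < n \<Longrightarrow> ((\<lambda>e. M e $$ (i, j)) \<longlongrightarrow> L $$ (i, j)) F"
    and F: "F \<noteq> bot" and ij: "i < n" "j < n"
  shows "((\<lambda>e. mat_fun f (M e) $$ (i, j)) \<longlongrightarrow> mat_fun f L $$ (i, j)) F"
proof -
  obtain r where r: "0 \<le> r" "\<And>i j. i < n \<Longrightarrow> j < n \<Longrightarrow> norm (L $$ (i, j)) \<le> r"
    using mat_entries_bounded[of n L] by blast
  \<comment> \<open>The entries of \<open>M e\<close> only approach those of \<open>L\<close>; the
    room between \<open>r\<close> and \<open>r + 1\<close> makes the bound hold eventually.\<close>
  have "\<forall>\<^sub>F e in F. norm (M e $$ (i, j)) \<le> r + 1" if "i < n" "j < n" for i j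
  proof -
    have "\<forall>\<^sub>F e in F. norm (M e $$ (i, j)) < r + 1"
      using tendsto_norm[OF lim[OF that]] r(2)[OF that] by (intro order_tendstoD) auto
    then show ?thesis
      by eventually_elim simp
  qed
  then have "\<forall>\<^sub>F e in F. \<forall>i\<in>{..<n}. \<forall>j\<in>{..<n}. norm (M e $$ (i, j)) \<le> r + 1"
    by (intro eventually_ball_finite ballI) auto
  then have bound: "\<forall>\<^sub>F e in F. \<forall>k. norm (taylor_coeff f k * (M e ^\<^sub>m k) $$ (i, j))
      \<le> norm (taylor_coeff f k) * (1 + n * (r + 1)) ^ k"
  proof eventually_elim
    case (elim e)
    then show ?case
      using norm_pow_mat_index_le[OF M, of "r + 1" e i j] r(1) ij
      by (auto simp: norm_mult intro!: mult_left_mono)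
  qed
  have "\<forall>\<^sub>F (k, e) in at_top \<times>\<^sub>F F. norm (taylor_coeff f k * (M e ^\<^sub>m k) $$ (i, j))
      \<le> norm (taylor_coeff f k) * (1 + n * (r + 1)) ^ k"
    using eventually_compose_filterlim[OF bound filterlim_snd]
    by (rule eventually_mono) auto
  then have "((\<lambda>e. \<Sum>k. taylor_coeff f k * (M e ^\<^sub>m k) $$ (i, j)) \<longlongrightarrow>
      (\<Sum>k. taylor_coeff f k * (L ^\<^sub>m k) $$ (i, j))) F"
    by (intro conjunct2[OF conjunct2[OF tannerys_theorem]] tendsto_mult tendsto_const
        tendsto_pow_mat_index lim F) (use M L ij summable_norm_taylor_coeff[OF f] in auto)
  moreover have "mat_fun f N $$ (i, j) = (\<Sum>k. taylor_coeff f k * (N ^\<^sub>m k) $$ (i, j))"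
    if "N \<in> carrier_mat n n" for N
    using that ij by (simp add: mat_fun_def)
  ultimately show ?thesis
    using M L by simp
qed

text \<open>The nonnegative complex numbers form a closed half-line, cut out by closed conditions on
  the real and imaginary parts.\<close>

lemma tendsto_complex_nonneg:
  fixes g :: "'a \<Rightarrow> complex"
  assumes "(g \<longlongrightarrow> l) F" "F \<noteq> bot" "\<forall>\<^sub>F e in F. 0 \<le> g e"
  shows "0 \<le> l"
proof -
  have "closed {z :: complex. 0 \<le> z}"
    unfolding less_eq_complex_def
    by (auto intro!: closed_Collect_conj closed_Collect_le closed_Collect_eq continuous_intros)
  then show ?thesis
    using Lim_in_closed_set[of "{z. 0 \<le> z}" g F l] assms by auto
qed

section \<open>Block triangular matrices and the Sylvester equation\<close>

text \<open>The conjugation identity in inductive form: after substituting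
  \<open>B = A X - X C\<close>, one more factor produces \<open>A^k X C\<close> twice with opposite
  signs, and the upper right block telescopes.\<close>

lemma pow_block_triangular_mat:
  fixes A :: "'a::comm_ring_1 mat"
  assumes A: "A \<in> carrier_mat n1 n1" and B: "B \<in> carrier_mat n1 n2" and C: "C \<in> carrier_mat n2 n2"
    and X: "X \<in> carrier_mat n1 n2" and eq: "A * X - X * C = B"
  shows "four_block_mat A B (0\<^sub>m n2 n1) C ^\<^sub>m k =
    four_block_mat (A ^\<^sub>m k) (A ^\<^sub>m k * X - X * C ^\<^sub>m k) (0\<^sub>m n2 n1) (C ^\<^sub>m k)"
proof (induction k)
  case 0
  show ?case
    using A B C X by (intro eq_matI) auto
next
  case (Suc k)
  let ?P = "A ^\<^sub>m k" and ?Q = "C ^\<^sub>m k"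
  have P: "?P \<in> carrier_mat n1 n1" and Q: "?Q \<in> carrier_mat n2 n2"
    using A C by auto
  have AX: "A * X \<in> carrier_mat n1 n2" and XC: "X * C \<in> carrier_mat n1 n2"
    and PX: "?P * X \<in> carrier_mat n1 n2" and XQ: "X * ?Q \<in> carrier_mat n1 n2"
    using A C X P Q by auto
  have "?P * B + (?P * X - X * ?Q) * C = (?P * (A * X) - ?P * (X * C)) + (?P * X * C - X * ?Q * C)"
    unfolding eq[symmetric]
    using minus_mult_distrib_mat[OF PX XQ C] mult_minus_distrib_mat[OF P AX XC] by simp
  also have "?P * X * C = ?P * (X * C)"
    using assoc_mult_mat[OF P X C] by simp
  also have "?P * (A * X) = ?P * A * X"
    using assoc_mult_mat[OF P A X] by simp
  also have "X * ?Q * C = X * (?Q * C)"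
    using assoc_mult_mat[OF X Q C] by simp
  \<comment> \<open>The products are kept opaque, so that in each entry only the cancellation of
    \<open>?P * (X * C)\<close> remains.\<close>
  also have "?P * A * X - ?P * (X * C) + (?P * (X * C) - X * (?Q * C)) = ?P * A * X - X * (?Q * C)"
    using A C X P Q by (intro eq_matI) (auto simp del: index_mult_mat(1))
  finally have upper: "?P * B + (?P * X - X * ?Q) * C = ?P * A * X - X * (?Q * C)" .
  have U: "?P * X - X * ?Q \<in> carrier_mat n1 n2"
    using XQ by (rule minus_carrier_mat)
  have "?P * A + (?P * X - X * ?Q) * 0\<^sub>m n2 n1 = ?P * A"
    using mult_carrier_mat[OF P A] by (simp add: right_mult_zero_mat[OF U])
  moreover have "0\<^sub>m n2 n1 * A + ?Q * 0\<^sub>m n2 n1 = 0\<^sub>m n2 n1"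
    by (simp add: left_mult_zero_mat[OF A] right_mult_zero_mat[OF Q])
  moreover have "0\<^sub>m n2 n1 * B + ?Q * C = ?Q * C"
    using mult_carrier_mat[OF Q C] by (simp add: left_mult_zero_mat[OF B])
  ultimately show ?case
    unfolding pow_mat.simps Suc.IH mult_four_block_mat[OF P U zero_carrier_mat Q A B zero_carrier_mat C] upper
    by simp
qed

text \<open>The Taylor coefficients are summed against the block form of the powers. In each entry,
  multiplication by the fixed \<open>X\<close> is a finite sum and therefore commutes with the
  series.\<close>

lemma mat_fun_block_triangular_mat:
  assumes f: "entire f"
    and A: "A \<in> carrier_mat n1 n1" and B: "B \<in> carrier_mat n1 n2" and C: "C \<in> carrier_mat n2 n2"
    and X: "X \<in> carrier_mat n1 n2" and eq: "A * X - X * C = B"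
  shows "mat_fun f (four_block_mat A B (0\<^sub>m n2 n1) C) =
    four_block_mat (mat_fun f A) (mat_fun f A * X - X * mat_fun f C) (0\<^sub>m n2 n1) (mat_fun f C)"
    (is "mat_fun f ?M = ?R")
proof (rule eq_matI)
  have M: "?M \<in> carrier_mat (n1 + n2) (n1 + n2)" and fA: "mat_fun f A \<in> carrier_mat n1 n1"
    and fC: "mat_fun f C \<in> carrier_mat n2 n2"
    using A B C by auto
  show dims: "dim_row (mat_fun f ?M) = dim_row ?R" "dim_col (mat_fun f ?M) = dim_col ?R"
    using A C by (auto simp: mat_fun_def)
  fix i j
  assume "i < dim_row ?R" "j < dim_col ?R"
  then have ij: "i < n1 + n2" "j < n1 + n2"
    using fA fC by auto
  have Ak: "A ^\<^sub>m k \<in> carrier_mat n1 n1" and Ck: "C ^\<^sub>m k \<in> carrier_mat n2 n2" for k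
    using A C by auto
  have "(\<lambda>k. taylor_coeff f k * (?M ^\<^sub>m k) $$ (i, j)) sums ?R $$ (i, j)"
  proof -
    consider "i < n1" "j < n1" | "i < n1" "n1 \<le> j" | "n1 \<le> i" "j < n1" | "n1 \<le> i" "n1 \<le> j"
      by linarith
    then show ?thesis
    proof cases
      case 1
      then show ?thesis
        using ij mat_fun_sums[OF f A] fA fC carrier_matD[OF Ak] carrier_matD[OF Ck]
        by (simp add: pow_block_triangular_mat[OF A B C X eq])
    next
      case 2
      define j' where "j' = j - n1"
      have j': "j' < n2"
        using 2 ij by (simp add: j'_def)
      \<comment> \<open>The coefficient is attached to the entry of the power of \<open>A\<close> or
        \<open>C\<close>, so that each inner series is one that defines an entry of
        \<open>f(A)\<close> or \<open>f(C)\<close>.\<close>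
      have "(\<lambda>k. (\<Sum>l<n1. taylor_coeff f k * (A ^\<^sub>m k) $$ (i, l) * X $$ (l, j'))
            - (\<Sum>l<n2. X $$ (i, l) * (taylor_coeff f k * (C ^\<^sub>m k) $$ (l, j')))) sums
          ((\<Sum>l<n1. mat_fun f A $$ (i, l) * X $$ (l, j'))
            - (\<Sum>l<n2. X $$ (i, l) * mat_fun f C $$ (l, j')))"
        using 2 j' mat_fun_sums[OF f A] mat_fun_sums[OF f C]
        by (intro sums_diff sums_sum sums_mult sums_mult2) auto
      moreover have "(?M ^\<^sub>m k) $$ (i, j) = (\<Sum>l<n1. (A ^\<^sub>m k) $$ (i, l) * X $$ (l, j'))
            - (\<Sum>l<n2. X $$ (i, l) * (C ^\<^sub>m k) $$ (l, j'))" for k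
        using 2 ij j' carrier_matD[OF Ak] carrier_matD[OF Ck] carrier_matD[OF X]
        by (simp add: pow_block_triangular_mat[OF A B C X eq] j'_def [symmetric]
            index_mult_mat_sum[OF Ak X] index_mult_mat_sum[OF X Ck] del: index_mult_mat(1))
      moreover have "?R $$ (i, j) = (\<Sum>l<n1. mat_fun f A $$ (i, l) * X $$ (l, j'))
            - (\<Sum>l<n2. X $$ (i, l) * mat_fun f C $$ (l, j'))"
        using 2 ij j' carrier_matD[OF fA] carrier_matD[OF fC] carrier_matD[OF X]
        by (simp add: j'_def [symmetric]
            index_mult_mat_sum[OF fA X] index_mult_mat_sum[OF X fC] del: index_mult_mat(1))
      ultimately show ?thesis
        by (simp add: right_diff_distrib sum_distrib_left ac_simps)
    next
      case 3
      then show ?thesis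
        using ij fA fC carrier_matD[OF Ak] carrier_matD[OF Ck]
        by (simp add: pow_block_triangular_mat[OF A B C X eq])
    next
      case 4
      then show ?thesis
        using ij mat_fun_sums[OF f C] fA fC carrier_matD[OF Ak] carrier_matD[OF Ck]
        by (simp add: pow_block_triangular_mat[OF A B C X eq])
    qed
  qed
  with mat_fun_sums[OF f M ij] show "mat_fun f ?M $$ (i, j) = ?R $$ (i, j)"
    by (rule sums_unique2)
qed

text \<open>Both directions of the theorem and the monotonicity of the classes pass through this
  splitting. A real solution \<open>X\<close> stays a solution after the embedding into complex
  matrices, so nonnegativity of the image can be read off block by block.\<close>

lemma nonneg_mat_fun_block_triangular_iff:
  assumes f: "entire f"
    and A: "A \<in> carrier_mat n1 n1" and B: "B \<in> carrier_mat n1 n2" and C: "C \<in> carrier_mat n2 n2"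
    and X: "X \<in> carrier_mat n1 n2" and eq: "A * X - X * C = B"
  shows "nonneg_mat (mat_fun f (cmat (four_block_mat A B (0\<^sub>m n2 n1) C))) \<longleftrightarrow>
    nonneg_mat (mat_fun f (cmat A)) \<and>
    nonneg_mat (mat_fun f (cmat A) * cmat X - cmat X * mat_fun f (cmat C)) \<and>
    nonneg_mat (mat_fun f (cmat C))"
proof -
  have cA: "cmat A \<in> carrier_mat n1 n1" and cB: "cmat B \<in> carrier_mat n1 n2"
    and cC: "cmat C \<in> carrier_mat n2 n2" and cX: "cmat X \<in> carrier_mat n1 n2"
    using A B C X by auto
  have block: "cmat (four_block_mat A B (0\<^sub>m n2 n1) C) =
      four_block_mat (cmat A) (cmat B) (0\<^sub>m n2 n1) (cmat C)"
    using cmat_four_block_mat[OF A B _ C, of "0\<^sub>m n2 n1"] by simp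
  have eq': "cmat A * cmat X - cmat X * cmat C = cmat B"
    using A C X
    by (simp add: eq[symmetric] cmat_minus[of _ n1 n2] cmat_mult[of _ n1 n1] cmat_mult[of _ n1 n2])
  have fA: "mat_fun f (cmat A) \<in> carrier_mat n1 n1" and fC: "mat_fun f (cmat C) \<in> carrier_mat n2 n2"
    using cA cC by auto
  then have "mat_fun f (cmat A) * cmat X - cmat X * mat_fun f (cmat C) \<in> carrier_mat n1 n2"
    using cX by (intro minus_carrier_mat mult_carrier_mat[of _ n1 n2])
  from nonneg_four_block_mat_iff[OF fA this zero_carrier_mat fC] show ?thesis
    unfolding block mat_fun_block_triangular_mat[OF f cA cB cC cX eq'] by (simp add: nonneg_mat_def)
qed

text \<open>Padding \<open>A\<close> with zero blocks gives a matrix of size \<open>N\<close> whose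
  image has \<open>f(A)\<close> as its upper left block; the Sylvester equation involved is solved
  by \<open>X = 0\<close>.\<close>

lemma nonneg_preserving_antimono:
  assumes "n \<le> N" "f \<in> nonneg_preserving N"
  shows "f \<in> nonneg_preserving n"
proof -
  let ?Z = "0\<^sub>m (N - n) (N - n)"
  have f: "entire f"
    using assms(2) by (simp add: nonneg_preserving_def)
  have "nonneg_mat (mat_fun f (cmat A))" if A: "A \<in> carrier_mat n n" "nonneg_mat A" for A
  proof -
    let ?M = "four_block_mat A (0\<^sub>m n (N - n)) (0\<^sub>m (N - n) n) ?Z"
    have "?M \<in> carrier_mat N N"
      using four_block_carrier_mat[OF A(1), of ?Z "N - n" "N - n"] assms(1) by simp
    moreover have "nonneg_mat ?M"
      using A by (subst nonneg_four_block_mat_iff) (auto simp: nonneg_mat_def)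
    ultimately have "nonneg_mat (mat_fun f (cmat ?M))"
      using assms(2) by (auto simp: nonneg_preserving_def)
    then show ?thesis
      using nonneg_mat_fun_block_triangular_iff[OF f A(1), of "0\<^sub>m n (N - n)" "N - n" ?Z "0\<^sub>m n (N - n)"]
        A(1) by simp
  qed
  then show ?thesis
    using f by (simp add: nonneg_preserving_def)
qed

section \<open>Sylvester equations and spectra under the shift \<open>A + e I\<close>\<close>

lemma sum_div_mod:
  fixes g :: "nat \<Rightarrow> nat \<Rightarrow> 'a::comm_monoid_add"
  shows "(\<Sum>s<m * n. g (s div n) (s mod n)) = (\<Sum>k<m. \<Sum>l<n. g k l)"
proof -
  \<comment> \<open>Row-major order: the indices \<open>k * n + l\<close> with \<open>l < n\<close>
    make up row \<open>k\<close>.\<close>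
  have "(\<Sum>s\<in>{k * n..<k * n + n}. g (s div n) (s mod n)) = (\<Sum>l<n. g k l)" for k
    using sum.shift_bounds_nat_ivl[of "\<lambda>s. g (s div n) (s mod n)" 0 "k * n" n]
    by (simp add: atLeast0LessThan add.commute)
  then show ?thesis
    by (simp add: sum.nat_group[symmetric])
qed

text \<open>The map \<open>X \<mapsto> A X - X C\<close> is written as a matrix acting on vectors indexed by
  \<open>i * n2 + j\<close>; replacing \<open>A\<close> by \<open>A + e I\<close> adds \<open>e I\<close> to that matrix, which makes it
  singular for finitely many \<open>e\<close> only.\<close>

lemma finite_unsolvable_sylvester:
  fixes A :: "'a::field mat"
  assumes A: "A \<in> carrier_mat n1 n1" and C: "C \<in> carrier_mat n2 n2"
  shows "finite {e. \<exists>B \<in> carrier_mat n1 n2. \<forall>X \<in> carrier_mat n1 n2.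
    (A + e \<cdot>\<^sub>m 1\<^sub>m n1) * X - X * C \<noteq> B}" (is "finite ?U")
proof -
  \<comment> \<open>In Kronecker notation \<open>K = A \<otimes> I - I \<otimes> C^T\<close>: its
    entry at row \<open>(i, j)\<close> and column \<open>(k, l)\<close> is the coefficient of
    \<open>X $$ (k, l)\<close> in entry \<open>(i, j)\<close> of \<open>A X - X C\<close>.\<close>
  define K where "K = mat (n1 * n2) (n1 * n2) (\<lambda>(r, s).
    (if r mod n2 = s mod n2 then A $$ (r div n2, s div n2) else 0)
    - (if r div n2 = s div n2 then C $$ (s mod n2, r mod n2) else 0))"
  have K: "K \<in> carrier_mat (n1 * n2) (n1 * n2)"
    by (simp add: K_def)
  \<comment> \<open>\<open>char_matrix K (- e)\<close> is \<open>K + e I\<close>, invertible unless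
    \<open>- e\<close> is an eigenvalue of \<open>K\<close>. For any other \<open>e\<close>,
    applying the inverse to the vector of entries of \<open>B\<close> yields a solution.\<close>
  have "?U \<subseteq> uminus ` spectrum K"
  proof (rule subsetI, rule ccontr)
    fix e
    assume "e \<in> ?U" and "e \<notin> uminus ` spectrum K"
    then obtain B where B: "B \<in> carrier_mat n1 n2"
      and unsolvable: "\<And>X. X \<in> carrier_mat n1 n2 \<Longrightarrow> (A + e \<cdot>\<^sub>m 1\<^sub>m n1) * X - X * C \<noteq> B"
      by auto
    have "- e \<notin> spectrum K"
      using \<open>e \<notin> uminus ` spectrum K\<close> by (metis add.inverse_inverse imageI)
    then have "det (char_matrix K (- e)) \<noteq> 0"
      using eigenvalue_det[OF K] by (auto simp: spectrum_def)
    from det_non_zero_imp_unit[OF char_matrix_closed[OF K] this, of "()"]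
    obtain N where N: "N \<in> carrier_mat (n1 * n2) (n1 * n2)"
      and inv: "char_matrix K (- e) * N = 1\<^sub>m (n1 * n2)"
      by (auto simp: Units_def ring_mat_def)
    define b where "b = vec (n1 * n2) (\<lambda>r. B $$ (r div n2, r mod n2))"
    define x where "x = N *\<^sub>v b"
    have b: "b \<in> carrier_vec (n1 * n2)" and x: "x \<in> carrier_vec (n1 * n2)"
      using N by (auto simp: b_def x_def)
    have Kx: "char_matrix K (- e) *\<^sub>v x = b"
      unfolding x_def using inv b N K
      by (metis assoc_mult_mat_vec char_matrix_closed one_mult_mat_vec)
    define X where "X = mat n1 n2 (\<lambda>(i, j). vec_index x (i * n2 + j))"
    have X: "X \<in> carrier_mat n1 n2"
      by (simp add: X_def)
    have "(A + e \<cdot>\<^sub>m 1\<^sub>m n1) * X - X * C = B"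
    proof (rule eq_matI)
      fix i j
      assume "i < dim_row B" "j < dim_col B"
      then have ij: "i < n1" "j < n2"
        using B by auto
      define r where "r = i * n2 + j"
      \<comment> \<open>\<open>i * n2 + j < Suc i * n2 \<le> n1 * n2\<close>.\<close>
      have r: "r < n1 * n2" "r div n2 = i" "r mod n2 = j"
        using ij mult_le_mono1[of "Suc i" n1 n2] by (auto simp: r_def)
      have Xx: "X $$ (s div n2, s mod n2) = vec_index x s" if "s < n1 * n2" for s
        using that ij by (auto simp: X_def less_mult_imp_div_less)
      let ?g = "\<lambda>k l. ((if j = l then A $$ (i, k) else 0) - (if i = k then C $$ (l, j) else 0)) * X $$ (k, l)"
      have "B $$ (i, j) = vec_index (char_matrix K (- e) *\<^sub>v x) r"
        using r by (simp add: Kx b_def)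
      also have "char_matrix K (- e) *\<^sub>v x = K *\<^sub>v x + e \<cdot>\<^sub>v x"
        using K x by (intro eq_vecI) (auto simp: char_matrix_def add_scalar_prod_distrib[of _ "n1 * n2"])
      also have "vec_index (K *\<^sub>v x + e \<cdot>\<^sub>v x) r = vec_index (K *\<^sub>v x) r + e * X $$ (i, j)"
        using r x K ij by (simp add: X_def r_def)
      also have "vec_index (K *\<^sub>v x) r = (\<Sum>s<n1 * n2. ?g (s div n2) (s mod n2))"
        using x r by (auto simp: scalar_prod_def K_def Xx atLeast0LessThan intro!: sum.cong)
      also have "\<dots> = (\<Sum>k<n1. \<Sum>l<n2. ?g k l)"
        by (rule sum_div_mod)
      \<comment> \<open>Each indicator collapses one of the two summations: \<open>j = l\<close>
        leaves an entry of \<open>A * X\<close>, and \<open>i = k\<close> one of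
        \<open>X * C\<close>.\<close>
      also have "\<dots> = (\<Sum>k<n1. \<Sum>l<n2. if j = l then A $$ (i, k) * X $$ (k, l) else 0)
          - (\<Sum>k<n1. \<Sum>l<n2. if i = k then X $$ (k, l) * C $$ (l, j) else 0)"
        unfolding sum_subtractf[symmetric] by (intro sum.cong) (auto simp: algebra_simps)
      also have "(\<Sum>k<n1. \<Sum>l<n2. if j = l then A $$ (i, k) * X $$ (k, l) else 0) = (A * X) $$ (i, j)"
        using ij by (simp add: index_mult_mat_sum[OF A X])
      also have "(\<Sum>k<n1. \<Sum>l<n2. if i = k then X $$ (k, l) * C $$ (l, j) else 0) = (X * C) $$ (i, j)"
        using ij by (subst sum.swap) (simp add: index_mult_mat_sum[OF X C])
      finally have "B $$ (i, j) = (A * X) $$ (i, j) - (X * C) $$ (i, j) + e * X $$ (i, j)" .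
      moreover have "(A + e \<cdot>\<^sub>m 1\<^sub>m n1) * X = A * X + e \<cdot>\<^sub>m X"
        using A X by (simp add: add_mult_distrib_mat[of _ n1 n1] mult_smult_assoc_mat[of _ n1 n1])
      ultimately show "((A + e \<cdot>\<^sub>m 1\<^sub>m n1) * X - X * C) $$ (i, j) = B $$ (i, j)"
        using ij A X C by (simp del: index_mult_mat(1))
    qed (use A B C X in auto)
    with unsolvable[OF X] show False by simp
  qed
  then show ?thesis
    using card_finite_spectrum(1)[OF K] finite_subset by blast
qed

text \<open>The characteristic matrix of \<open>A + e I\<close> at \<open>c\<close> is that of
  \<open>A\<close> at \<open>c - e\<close>.\<close>

lemma spectrum_add_smult_one:
  fixes A :: "'a::field mat"
  assumes A: "A \<in> carrier_mat n n" and "c \<in> spectrum (A + e \<cdot>\<^sub>m 1\<^sub>m n)"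
  shows "c - e \<in> spectrum A"
proof -
  have "char_matrix (A + e \<cdot>\<^sub>m 1\<^sub>m n) c = char_matrix A (c - e)"
    using A by (intro eq_matI) (auto simp: char_matrix_def)
  then show ?thesis
    using assms by (simp add: spectrum_def eigenvalue_char_matrix[of _ n])
qed

text \<open>A common eigenvalue \<open>c\<close> makes \<open>c - e\<close> an eigenvalue of
  \<open>A\<close>, so \<open>e\<close> is the difference of an eigenvalue of \<open>C\<close> and
  one of \<open>A\<close>. These differences are finitely many complex numbers, and
  \<open>Re\<close> recovers the real shift.\<close>

lemma finite_common_spectrum_shift:
  assumes A: "A \<in> carrier_mat n1 n1" and C: "C \<in> carrier_mat n2 n2"
  shows "finite {e. spectrum (cmat (A + e \<cdot>\<^sub>m 1\<^sub>m n1)) \<inter> spectrum (cmat C) \<noteq> {}}" (is "finite ?S")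
proof -
  have "?S \<subseteq> (\<lambda>(a, c). Re (c - a)) ` (spectrum (cmat A) \<times> spectrum (cmat C))"
  proof
    fix e
    assume "e \<in> ?S"
    then obtain c where c: "c \<in> spectrum (cmat (A + e \<cdot>\<^sub>m 1\<^sub>m n1))" "c \<in> spectrum (cmat C)"
      by auto
    have "cmat (A + e \<cdot>\<^sub>m 1\<^sub>m n1) = cmat A + of_real e \<cdot>\<^sub>m 1\<^sub>m n1"
      using A by (intro eq_matI) (auto simp: cmat_def)
    then have "c - of_real e \<in> spectrum (cmat A)"
      using spectrum_add_smult_one[of "cmat A" n1 c "of_real e"] c(1) A by simp
    then show "e \<in> (\<lambda>(a, c). Re (c - a)) ` (spectrum (cmat A) \<times> spectrum (cmat C))"
      using c(2) by (intro image_eqI[of _ _ "(c - of_real e, c)"]) auto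
  qed
  moreover have "finite (spectrum (cmat A) \<times> spectrum (cmat C))"
    using A C by (intro finite_cartesian_product card_finite_spectrum(1)) auto
  ultimately show ?thesis
    using finite_subset by blast
qed

section \<open>Preservation on block triangular matrices and the two conditions\<close>

theorem corollary9:
  fixes n\<^sub>1 n\<^sub>2 :: nat and f :: "complex \<Rightarrow> complex"
  assumes "n\<^sub>1 \<ge> 1" and "n\<^sub>2 \<ge> 1" and "entire f"
  shows "preserves_block_triangular n\<^sub>1 n\<^sub>2 f \<longleftrightarrow>
    f \<in> nonneg_preserving (max n\<^sub>1 n\<^sub>2) \<and>
    (\<forall>A \<in> carrier_mat n\<^sub>1 n\<^sub>1. \<forall>B \<in> carrier_mat n\<^sub>1 n\<^sub>2. \<forall>C \<in> carrier_mat n\<^sub>2 n\<^sub>2.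
       nonneg_mat A \<and> nonneg_mat B \<and> nonneg_mat C \<and>
       spectrum (cmat A) \<inter> spectrum (cmat C) = {} \<longrightarrow>
       (\<forall>X \<in> carrier_mat n\<^sub>1 n\<^sub>2. A * X - X * C = B \<longrightarrow>
          nonneg_mat (mat_fun f (cmat A) * cmat X - cmat X * mat_fun f (cmat C))))"
proof (intro iffI conjI ballI impI)
  assume pres: "preserves_block_triangular n\<^sub>1 n\<^sub>2 f"
  \<comment> \<open>Used with \<open>X = 0\<close> and a zero matrix as the other diagonal block for
    condition (a), and with the given \<open>X\<close> for condition (b).\<close>
  have blocks: "nonneg_mat (mat_fun f (cmat A)) \<and>
      nonneg_mat (mat_fun f (cmat A) * cmat X - cmat X * mat_fun f (cmat C)) \<and>
      nonneg_mat (mat_fun f (cmat C))"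
    if A: "A \<in> carrier_mat n\<^sub>1 n\<^sub>1" and B: "B \<in> carrier_mat n\<^sub>1 n\<^sub>2" and C: "C \<in> carrier_mat n\<^sub>2 n\<^sub>2"
      and nonneg: "nonneg_mat A" "nonneg_mat B" "nonneg_mat C"
      and X: "X \<in> carrier_mat n\<^sub>1 n\<^sub>2" and eq: "A * X - X * C = B" for A B C X
  proof -
    have "nonneg_mat (four_block_mat A B (0\<^sub>m n\<^sub>2 n\<^sub>1) C)"
      using nonneg nonneg_four_block_mat_iff[OF A B _ C, of "0\<^sub>m n\<^sub>2 n\<^sub>1"] by (simp add: nonneg_mat_def)
    then have "nonneg_mat (mat_fun f (cmat (four_block_mat A B (0\<^sub>m n\<^sub>2 n\<^sub>1) C)))"
      using pres A B C by (auto simp: preserves_block_triangular_def Let_def)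
    then show ?thesis
      by (simp add: nonneg_mat_fun_block_triangular_iff[OF assms(3) A B C X eq])
  qed
  have "f \<in> nonneg_preserving n\<^sub>1"
    using blocks[of _ "0\<^sub>m n\<^sub>1 n\<^sub>2" "0\<^sub>m n\<^sub>2 n\<^sub>2" "0\<^sub>m n\<^sub>1 n\<^sub>2"] assms(3)
    by (auto simp: nonneg_preserving_def nonneg_mat_def)
  moreover have "f \<in> nonneg_preserving n\<^sub>2"
    using blocks[of "0\<^sub>m n\<^sub>1 n\<^sub>1" "0\<^sub>m n\<^sub>1 n\<^sub>2" _ "0\<^sub>m n\<^sub>1 n\<^sub>2"] assms(3)
    by (auto simp: nonneg_preserving_def nonneg_mat_def)
  ultimately show "f \<in> nonneg_preserving (max n\<^sub>1 n\<^sub>2)"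
    by (simp add: max_def)
  fix A B C X
  assume "A \<in> carrier_mat n\<^sub>1 n\<^sub>1" "B \<in> carrier_mat n\<^sub>1 n\<^sub>2" "C \<in> carrier_mat n\<^sub>2 n\<^sub>2" "X \<in> carrier_mat n\<^sub>1 n\<^sub>2"
    and "nonneg_mat A \<and> nonneg_mat B \<and> nonneg_mat C \<and> spectrum (cmat A) \<inter> spectrum (cmat C) = {}"
    and "A * X - X * C = B"
  then show "nonneg_mat (mat_fun f (cmat A) * cmat X - cmat X * mat_fun f (cmat C))"
    using blocks by blast
next
  assume conds: "f \<in> nonneg_preserving (max n\<^sub>1 n\<^sub>2) \<and>
    (\<forall>A \<in> carrier_mat n\<^sub>1 n\<^sub>1. \<forall>B \<in> carrier_mat n\<^sub>1 n\<^sub>2. \<forall>C \<in> carrier_mat n\<^sub>2 n\<^sub>2.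
       nonneg_mat A \<and> nonneg_mat B \<and> nonneg_mat C \<and>
       spectrum (cmat A) \<inter> spectrum (cmat C) = {} \<longrightarrow>
       (\<forall>X \<in> carrier_mat n\<^sub>1 n\<^sub>2. A * X - X * C = B \<longrightarrow>
          nonneg_mat (mat_fun f (cmat A) * cmat X - cmat X * mat_fun f (cmat C))))"
  then have pres: "f \<in> nonneg_preserving n\<^sub>1" "f \<in> nonneg_preserving n\<^sub>2"
    by (auto intro: nonneg_preserving_antimono[of _ "max n\<^sub>1 n\<^sub>2"])
  have "nonneg_mat (mat_fun f (cmat (four_block_mat A B (0\<^sub>m n\<^sub>2 n\<^sub>1) C)))"
    if A: "A \<in> carrier_mat n\<^sub>1 n\<^sub>1" and B: "B \<in> carrier_mat n\<^sub>1 n\<^sub>2" and C: "C \<in> carrier_mat n\<^sub>2 n\<^sub>2"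
      and nonneg: "nonneg_mat A" "nonneg_mat B" "nonneg_mat C" for A B C
  proof -
    define A' where "A' e = A + e \<cdot>\<^sub>m 1\<^sub>m n\<^sub>1" for e
    define M where "M e = cmat (four_block_mat (A' e) B (0\<^sub>m n\<^sub>2 n\<^sub>1) C)" for e
    have A': "A' e \<in> carrier_mat n\<^sub>1 n\<^sub>1" for e
      using A by (simp add: A'_def)
    have M: "M e \<in> carrier_mat (n\<^sub>1 + n\<^sub>2) (n\<^sub>1 + n\<^sub>2)" for e
      using A' C by (simp add: M_def)
    have M0: "M 0 = cmat (four_block_mat A B (0\<^sub>m n\<^sub>2 n\<^sub>1) C)"
    proof -
      have "A' 0 = A"
        using A by (intro eq_matI) (auto simp: A'_def)
      then show ?thesis by (simp add: M_def)
    qed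
    \<comment> \<open>Outside the first set the equation is solvable for every right-hand side, in
      particular for the given \<open>B\<close>; outside the second, condition (b) applies to
      \<open>A' e\<close> and \<open>C\<close>.\<close>
    define bad where "bad = {e. \<exists>B \<in> carrier_mat n\<^sub>1 n\<^sub>2. \<forall>X \<in> carrier_mat n\<^sub>1 n\<^sub>2. A' e * X - X * C \<noteq> B}
      \<union> {e. spectrum (cmat (A' e)) \<inter> spectrum (cmat C) \<noteq> {}}"
    have "finite bad"
      unfolding bad_def A'_def
      using finite_unsolvable_sylvester[OF A C] finite_common_spectrum_shift[OF A C] by simp
    have good: "nonneg_mat (mat_fun f (M e))" if e: "e > 0" "e \<notin> bad" for e
    proof -
      obtain X where X: "X \<in> carrier_mat n\<^sub>1 n\<^sub>2" "A' e * X - X * C = B"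
        using e(2) B by (auto simp: bad_def)
      \<comment> \<open>A positive \<open>e\<close> only raises the diagonal, hence the one-sided
        limit below.\<close>
      have "nonneg_mat (A' e)"
        using nonneg(1) e(1) A unfolding nonneg_mat_iff[OF A] nonneg_mat_iff[OF A']
        by (auto simp: A'_def)
      moreover have "spectrum (cmat (A' e)) \<inter> spectrum (cmat C) = {}"
        using e(2) by (auto simp: bad_def)
      ultimately have "nonneg_mat (mat_fun f (cmat (A' e)))" "nonneg_mat (mat_fun f (cmat C))"
        "nonneg_mat (mat_fun f (cmat (A' e)) * cmat X - cmat X * mat_fun f (cmat C))"
        using pres conds A' B C X nonneg by (auto simp: nonneg_preserving_def)
      then show ?thesis
        unfolding M_def by (simp add: nonneg_mat_fun_block_triangular_iff[OF assms(3) A' B C X])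
    qed
    \<comment> \<open>A finite set has no limit point. The filter \<open>at 0\<close> leaves out
      \<open>0\<close> itself, which lies in \<open>bad\<close> when the spectra of \<open>A\<close>
      and \<open>C\<close> meet.\<close>
    have "\<forall>\<^sub>F e in at 0. e \<notin> bad"
      using islimpt_finite[OF \<open>finite bad\<close>, of 0] by (simp add: islimpt_iff_eventually)
    then have "\<forall>\<^sub>F e in at_right 0. e \<notin> bad"
      by (rule filter_leD[OF at_le[OF subset_UNIV]])
    then have ev: "\<forall>\<^sub>F e in at_right 0. nonneg_mat (mat_fun f (M e))"
      using eventually_at_right_less[of 0] by eventually_elim (rule good)
    \<comment> \<open>Only the upper left block varies with \<open>e\<close>, and its entries are
      affine in \<open>e\<close>.\<close>
    have lim: "((\<lambda>e. M e $$ (i, j)) \<longlongrightarrow> M 0 $$ (i, j)) (at_right 0)"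
      if "i < n\<^sub>1 + n\<^sub>2" "j < n\<^sub>1 + n\<^sub>2" for i j
    proof -
      have "((\<lambda>e. complex_of_real (A' e $$ (i, j))) \<longlongrightarrow> complex_of_real (A' 0 $$ (i, j))) (at_right 0)"
        if "i < n\<^sub>1" "j < n\<^sub>1"
        using that A by (auto simp: A'_def intro!: tendsto_eq_intros)
      moreover have "dim_row (A' e) = n\<^sub>1" "dim_col (A' e) = n\<^sub>1" for e
        using A' by auto
      ultimately show ?thesis
        using that C by (auto simp: M_def cmat_def)
    qed
    have "0 \<le> mat_fun f (M 0) $$ (i, j)" if ij: "i < n\<^sub>1 + n\<^sub>2" "j < n\<^sub>1 + n\<^sub>2" for i j
    proof (rule tendsto_complex_nonneg)
      show "((\<lambda>e. mat_fun f (M e) $$ (i, j)) \<longlongrightarrow> mat_fun f (M 0) $$ (i, j)) (at_right 0)"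
        by (rule tendsto_mat_fun_index[OF assms(3) M M lim _ ij]) auto
      show "\<forall>\<^sub>F e in at_right 0. 0 \<le> mat_fun f (M e) $$ (i, j)"
        using ev by eventually_elim (use ij nonneg_mat_iff[OF mat_fun_carrier[OF M]] in auto)
    qed simp
    then show ?thesis
      unfolding M0[symmetric] nonneg_mat_iff[OF mat_fun_carrier[OF M]] by blast
  qed
  then show "preserves_block_triangular n\<^sub>1 n\<^sub>2 f"
    by (auto simp: preserves_block_triangular_def Let_def nonneg_four_block_mat_iff[of _ n\<^sub>1 n\<^sub>1 _ n\<^sub>2 _ n\<^sub>2])
qed

end
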